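(* Let $(a_n)_{n\ge1}$ be a sequence of distinct positive real numbers such that $\inf_{1\le m\ne n\le N}|a_m-a_n|\ge c(N)$ for all $N$, where $(c(N))_{N\ge1}$ is a monotone decreasing sequence of positive reals. Let $\epsilon>0$, and let $D_N=\#\{|a_m-a_n|:1\le m\ne n\le N\}$. Then for almost all $\alpha\in[0,1]$ and all sufficiently large $N$ (depending on $\alpha$): (a) $\delta^{\alpha}_{\min}(N)\ge \dfrac{c(N)}{D_N\log N(\log_2 N)^{1+\epsilon}}$, and (b) $\delta^{\alpha}_{\min}(N)\le 1-\dfrac{c(N)}{D_N\log N(\log_2 N)^{1+\epsilon}}$.
   Context: $\|x\|=\min_{k\in\mathbb Z}|x-k|$; $\delta^{\alpha}_{\min}(N)=\min\{\|\alpha(a_m-a_n)\|:1\le m\ne n\le N\}$. $\log x$ denotes $\max(1,\log x)$ (natural log) and $\log_2 x=\log(\log x)$ with the same convention. "Almost all" refers to Lebesgue measure. *)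

theory Defs
  imports "HOL-Analysis.Analysis"
begin

definition dist_nearest_int :: "real \<Rightarrow> real" where
  "dist_nearest_int x = (INF k::int. \<bar>x - of_int k\<bar>)"

text \<open>The infimum is attained, so it is the minimum over the integers.\<close>

lemma dist_nearest_int_eq_round: "dist_nearest_int x = \<bar>x - of_int (round x)\<bar>"
  unfolding dist_nearest_int_def
  by (rule cInf_eq_minimum) (auto simp: round_diff_minimal)

definition trunc_log :: "real \<Rightarrow> real" where
  "trunc_log x = max 1 (ln x)"

text \<open>The second iterate of the truncated logarithm, not a logarithm to base 2.\<close>

definition trunc_log2 :: "real \<Rightarrow> real" where
  "trunc_log2 x = trunc_log (trunc_log x)"

definition index_pairs :: "nat \<Rightarrow> (nat \<times> nat) set" where
  "index_pairs N = {(m, n). m \<in> {1..N} \<and> n \<in> {1..N} \<and> m \<noteq> n}"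

text \<open>Meaningful only for \<open>N \<ge> 2\<close>: for smaller \<open>N\<close> the minimum is over the empty set.\<close>

definition delta_min :: "(nat \<Rightarrow> real) \<Rightarrow> real \<Rightarrow> nat \<Rightarrow> real" where
  "delta_min a \<alpha> N = Min ((\<lambda>(m, n). dist_nearest_int (\<alpha> * (a m - a n))) ` index_pairs N)"

definition num_differences :: "(nat \<Rightarrow> real) \<Rightarrow> nat \<Rightarrow> nat" where
  "num_differences a N = card ((\<lambda>(m, n). \<bar>a m - a n\<bar>) ` index_pairs N)"

end

theory Submission
  imports Defs "HOL-Real_Asymp.Real_Asymp"
begin

text \<open>A difference \<open>d\<close> need only be tested at the first \<open>N\<close> at which it occurs, because the
  threshold \<open>\<eta> N\<close> on the right of (a) decreases. A new difference satisfies \<open>d \<ge> c N\<close>, so the set of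
  \<open>\<alpha> \<in> [0,1]\<close> with \<open>\<parallel>\<alpha> d\<parallel> < \<eta> N\<close> has measure \<open>O(\<eta> N / c N)\<close>, and all new differences
  together contribute \<open>O((D N - D (N - 1)) / (D N log N (log log N) powr (1 + \<epsilon>)))\<close>. As \<open>D N \<le> N\<^sup>2\<close>, this is
  dominated by the increment of \<open>- (ln (ln x)) powr (- \<epsilon>)\<close> between \<open>D (N - 1)\<close> and \<open>D N\<close>, so the
  series telescopes and converges. By Borel--Cantelli only finitely many differences violate their
  threshold, and for those \<open>\<parallel>\<alpha> d\<parallel> > 0\<close> almost surely while \<open>\<eta> N \<longlonglongrightarrow> 0\<close>. Part (b) is immediate from
  \<open>\<parallel>x\<parallel> \<le> 1/2\<close>.\<close>

section \<open>The set of differences and its growth\<close>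

definition differences :: "(nat \<Rightarrow> real) \<Rightarrow> nat \<Rightarrow> real set" where
  "differences a N = (\<lambda>(m, n). \<bar>a m - a n\<bar>) ` index_pairs N"

lemma num_differences_eq_card: "num_differences a N = card (differences a N)"
  by (simp add: num_differences_def differences_def)

lemma finite_index_pairs: "finite (index_pairs N)"
  by (rule finite_subset[of _ "{1..N} \<times> {1..N}"]) (auto simp: index_pairs_def)

lemma card_index_pairs_le: "card (index_pairs N) \<le> N * (N - 1)"
proof -
  have eq: "index_pairs N = {1..N} \<times> {1..N} - (\<lambda>n. (n, n)) ` {1..N}"
    by (auto simp: index_pairs_def)
  have "card ((\<lambda>n. (n, n)) ` {1..N}) = N"
    by (subst card_image) (auto simp: inj_on_def)
  then have "card (index_pairs N) = N * N - N"
    unfolding eq by (subst card_Diff_subset) auto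
  then show ?thesis by (simp add: algebra_simps)
qed

lemma finite_differences [simp]: "finite (differences a N)"
  by (simp add: differences_def finite_index_pairs)

lemma differences_mono: "M \<le> N \<Longrightarrow> differences a M \<subseteq> differences a N"
  unfolding differences_def by (intro image_mono) (auto simp: index_pairs_def)

lemma num_differences_mono: "M \<le> N \<Longrightarrow> num_differences a M \<le> num_differences a N"
  by (simp add: num_differences_eq_card card_mono differences_mono)

lemma num_differences_le: "num_differences a N \<le> N * (N - 1)"
  unfolding num_differences_def
  using card_image_le[OF finite_index_pairs] card_index_pairs_le le_trans by blast

lemma index_pairs_nonempty:
  assumes "N \<ge> 2"
  shows "index_pairs N \<noteq> {}"
proof -
  have "(1, 2) \<in> index_pairs N" using assms by (auto simp: index_pairs_def)
  then show ?thesis by blast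
qed

lemma num_differences_pos: "N \<ge> 2 \<Longrightarrow> num_differences a N \<ge> 1"
  using index_pairs_nonempty[of N]
  by (simp add: num_differences_def Suc_le_eq card_gt_0_iff finite_index_pairs)

lemma differences_0 [simp]: "differences a 0 = {}"
  by (auto simp: differences_def index_pairs_def)

text \<open>Since \<open>differences a 0\<close> is empty, the least index at which \<open>d\<close>
  occurs is a successor. Each difference can therefore be charged to the single step at which it is
  new.\<close>

lemma first_appearance_of_difference:
  assumes "d \<in> differences a N"
  obtains M where "M < N" "d \<in> differences a (Suc M) - differences a M"
proof -
  define K where "K = (LEAST n. d \<in> differences a n)"
  have K: "d \<in> differences a K" unfolding K_def using assms by (rule LeastI)
  have "K \<le> N" unfolding K_def using assms by (rule Least_le)
  obtain M where M: "K = Suc M" using K by (cases K) auto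
  have "d \<notin> differences a M"
    using M not_less_Least[of M "\<lambda>n. d \<in> differences a n"] by (simp add: K_def)
  then show thesis using that[of M] K M \<open>K \<le> N\<close> by auto
qed

section \<open>Distance to the nearest integer\<close>

lemma dist_nearest_int_le: "dist_nearest_int x \<le> \<bar>x - of_int k\<bar>"
  by (simp add: dist_nearest_int_eq_round round_diff_minimal)

text \<open>The minimum is attained at \<open>round x\<close>. This turns sublevel sets into unions
  of open sets over the integers.\<close>

lemma dist_nearest_int_less_iff: "dist_nearest_int x < \<eta> \<longleftrightarrow> (\<exists>k::int. \<bar>x - of_int k\<bar> < \<eta>)"
  using dist_nearest_int_le[of x] dist_nearest_int_eq_round[of x] le_less_trans by metis

lemma dist_nearest_int_le_half: "dist_nearest_int x \<le> 1/2"
  unfolding dist_nearest_int_eq_round using of_int_round_abs_le[of x]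
  by (simp add: abs_minus_commute)

lemma dist_nearest_int_minus [simp]: "dist_nearest_int (- x) = dist_nearest_int x"
proof -
  have "dist_nearest_int (- y) \<le> dist_nearest_int y" for y
    using dist_nearest_int_le[of "- y" "- round y"] unfolding dist_nearest_int_eq_round[of y]
    by (simp add: abs_minus_commute)
  from this[of x] this[of "- x"] show ?thesis by simp
qed

lemma dist_nearest_int_pos: "x \<notin> \<int> \<Longrightarrow> dist_nearest_int x > 0"
  unfolding dist_nearest_int_eq_round by (metis Ints_of_int eq_iff_diff_eq_0 zero_less_abs_iff)

lemma dist_nearest_int_mult_abs: "dist_nearest_int (x * \<bar>y\<bar>) = dist_nearest_int (x * y)"
  by (cases "y \<ge> 0") simp_all

section \<open>Measure of the exceptional multipliers of one difference\<close>

definition close_multipliers :: "real \<Rightarrow> real \<Rightarrow> real set" where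
  "close_multipliers d \<eta> = {\<alpha>\<in>{0..1}. dist_nearest_int (\<alpha> * d) < \<eta>}"

lemma close_multipliers_lmeasurable: "close_multipliers d \<eta> \<in> lmeasurable"
proof -
  have "{\<alpha>. dist_nearest_int (\<alpha> * d) < \<eta>} = (\<Union>k::int. {\<alpha>. \<bar>\<alpha> * d - of_int k\<bar> < \<eta>})"
    by (auto simp: dist_nearest_int_less_iff)
  moreover have "open (\<Union>k::int. {\<alpha>. \<bar>\<alpha> * d - of_int k\<bar> < \<eta>})"
    by (intro open_UN ballI open_Collect_less continuous_intros)
  ultimately have "open {\<alpha>. dist_nearest_int (\<alpha> * d) < \<eta>}" by simp
  then have "{0..1} \<inter> {\<alpha>. dist_nearest_int (\<alpha> * d) < \<eta>} \<in> lmeasurable"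
    by (intro fmeasurable_Int_fmeasurable) auto
  also have "{0..1} \<inter> {\<alpha>. dist_nearest_int (\<alpha> * d) < \<eta>} = close_multipliers d \<eta>"
    by (auto simp: close_multipliers_def)
  finally show ?thesis .
qed

text \<open>Each integer \<open>k\<close> accounts for an interval of length
  \<open>2 * \<eta> / d\<close>, and at most \<open>d + 2\<close> integers lie near a point of
  \<open>{0..d}\<close>. The term \<open>2 * \<eta>\<close> alone covers large \<eta>, where the
  trivial bound 1 is used.\<close>

lemma measure_close_multipliers_le:
  assumes "d > 0" "\<eta> \<ge> 0"
  shows "measure lebesgue (close_multipliers d \<eta>) \<le> 2 * \<eta> + 4 * \<eta> / d"
proof (cases "\<eta> \<le> 1/2")
  case False
  have "measure lebesgue (close_multipliers d \<eta>) \<le> measure lebesgue {0..1::real}"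
    by (rule measure_mono_fmeasurable[OF _ fmeasurableD[OF close_multipliers_lmeasurable]])
      (auto simp: close_multipliers_def)
  also have "\<dots> \<le> 2 * \<eta>" using False by simp
  also have "\<dots> \<le> 2 * \<eta> + 4 * \<eta> / d" using assms by simp
  finally show ?thesis .
next
  case True
  let ?B = "\<lambda>k::int. {(of_int k - \<eta>) / d .. (of_int k + \<eta>) / d}"
  \<comment> \<open>As \<eta> is at most 1/2 and \<open>\<alpha> * d\<close> lies between 0 and
    \<open>d\<close>, an integer that close to it exceeds -1 and is at most
    \<open>\<lfloor>d\<rfloor> + 1\<close>.\<close>
  have sub: "close_multipliers d \<eta> \<subseteq> (\<Union>k\<in>{0..\<lfloor>d\<rfloor> + 1}. ?B k)"
  proof
    fix \<alpha> assume \<alpha>: "\<alpha> \<in> close_multipliers d \<eta>"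
    then obtain k :: int where k: "\<bar>\<alpha> * d - of_int k\<bar> < \<eta>"
      by (auto simp: close_multipliers_def dist_nearest_int_less_iff)
    have \<alpha>d: "0 \<le> \<alpha> * d" "\<alpha> * d \<le> d"
      using \<alpha> \<open>d > 0\<close> by (auto simp: close_multipliers_def)
    have "real_of_int k > -1" using k \<alpha>d True by linarith
    moreover have "k \<le> \<lfloor>d\<rfloor> + 1" using k \<alpha>d True by linarith
    moreover have "\<alpha> \<in> ?B k" using k \<open>d > 0\<close> by (auto simp: field_simps abs_less_iff)
    ultimately show "\<alpha> \<in> (\<Union>k\<in>{0..\<lfloor>d\<rfloor> + 1}. ?B k)" by (intro UN_I[of k]) auto
  qed
  have "measure lebesgue (close_multipliers d \<eta>) \<le> measure lebesgue (\<Union>k\<in>{0..\<lfloor>d\<rfloor> + 1}. ?B k)"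
    by (rule measure_mono_fmeasurable[OF sub fmeasurableD[OF close_multipliers_lmeasurable]])
      (intro fmeasurable.finite_UN; simp)
  also have "\<dots> \<le> (\<Sum>k\<in>{0..\<lfloor>d\<rfloor> + 1}. measure lebesgue (?B k))"
    by (rule measure_UNION_le) auto
  also have "\<dots> = (\<Sum>k\<in>{0..\<lfloor>d\<rfloor> + 1}. 2 * \<eta> / d)"
    using assms by (intro sum.cong refl) (simp add: divide_right_mono field_simps)
  also have "\<dots> = of_int (\<lfloor>d\<rfloor> + 2) * (2 * \<eta> / d)"
    using \<open>d > 0\<close> by (simp add: algebra_simps)
  also have "\<dots> \<le> (d + 2) * (2 * \<eta> / d)"
    using assms by (intro mult_right_mono) auto
  also have "\<dots> = 2 * \<eta> + 4 * \<eta> / d" using \<open>d > 0\<close> by (simp add: field_simps)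
  finally show ?thesis .
qed

text \<open>The exceptional \<alpha> are quotients of an integer by an element of \<open>D\<close>,
  hence countably many.\<close>

lemma AE_mult_notin_Ints:
  assumes "countable D" "0 \<notin> D"
  shows "AE \<alpha> in lebesgue. \<forall>d\<in>D. \<alpha> * d \<notin> (\<int> :: real set)"
proof -
  have "countable ((\<lambda>(k, d). k / d) ` ((\<int> :: real set) \<times> D))"
    using assms by (intro countable_image countable_SIGMA) (auto simp: Ints_def)
  then have "(\<lambda>(k, d). k / d) ` ((\<int> :: real set) \<times> D) \<in> null_sets lebesgue"
    using countable_imp_null_set_lborel null_sets_completionI by blast
  then show ?thesis
  proof (rule AE_I')
    show "{\<alpha> \<in> space lebesgue. \<not> (\<forall>d\<in>D. \<alpha> * d \<notin> (\<int> :: real set))}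
        \<subseteq> (\<lambda>(k, d). k / d) ` ((\<int> :: real set) \<times> D)"
    proof
      fix \<alpha> :: real
      assume "\<alpha> \<in> {\<alpha> \<in> space lebesgue. \<not> (\<forall>d\<in>D. \<alpha> * d \<notin> (\<int> :: real set))}"
      then obtain d where "d \<in> D" "\<alpha> * d \<in> \<int>" by auto
      moreover from this have "\<alpha> = (\<alpha> * d) / d" using assms by auto
      ultimately show "\<alpha> \<in> (\<lambda>(k, d). k / d) ` ((\<int> :: real set) \<times> D)" by force
    qed
  qed
qed

section \<open>Truncated logarithms and the logarithmic weight\<close>

lemma trunc_log_mono: "0 < x \<Longrightarrow> x \<le> y \<Longrightarrow> trunc_log x \<le> trunc_log y"
  unfolding trunc_log_def by (intro max.mono) auto

lemma trunc_log_ge_1: "trunc_log x \<ge> 1"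
  by (simp add: trunc_log_def)

lemma trunc_log2_mono: "0 < x \<Longrightarrow> x \<le> y \<Longrightarrow> trunc_log2 x \<le> trunc_log2 y"
  unfolding trunc_log2_def
  by (intro trunc_log_mono order.strict_trans2[OF zero_less_one trunc_log_ge_1])

lemma trunc_log2_ge_1: "trunc_log2 x \<ge> 1"
  by (simp add: trunc_log2_def trunc_log_ge_1)

definition log_weight :: "real \<Rightarrow> real \<Rightarrow> real" where
  "log_weight \<epsilon> x = trunc_log x * trunc_log2 x powr (1 + \<epsilon>)"

lemma log_weight_mono:
  assumes "\<epsilon> > 0" "0 < x" "x \<le> y"
  shows "log_weight \<epsilon> x \<le> log_weight \<epsilon> y"
  unfolding log_weight_def using assms trunc_log_ge_1[of y] trunc_log2_ge_1[of x]
  by (intro mult_mono powr_mono2 trunc_log_mono trunc_log2_mono) auto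

lemma log_weight_ge_trunc_log:
  assumes "\<epsilon> > 0"
  shows "log_weight \<epsilon> x \<ge> trunc_log x"
  unfolding log_weight_def
  using ge_one_powr_ge_zero[OF trunc_log2_ge_1, of "1 + \<epsilon>" x] assms trunc_log_ge_1[of x]
    mult_left_mono[of 1 "trunc_log2 x powr (1 + \<epsilon>)" "trunc_log x"] by simp

lemma log_weight_ge_1: "\<epsilon> > 0 \<Longrightarrow> log_weight \<epsilon> x \<ge> 1"
  using log_weight_ge_trunc_log trunc_log_ge_1 order_trans by blast

text \<open>Squaring at most doubles each of the two logarithmic factors. This makes the weight at a
  number of size up to \<open>N\<^sup>2\<close> comparable with the weight at
  \<open>N\<close>.\<close>

lemma log_weight_square_le:
  assumes "\<epsilon> > 0" "x > 0"
  shows "log_weight \<epsilon> (x\<^sup>2) \<le> 2 powr (2 + \<epsilon>) * log_weight \<epsilon> x"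
proof -
  have tl: "trunc_log (x\<^sup>2) \<le> 2 * trunc_log x"
    using assms by (auto simp: trunc_log_def ln_realpow)
  have "trunc_log2 (x\<^sup>2) \<le> trunc_log (2 * trunc_log x)"
    unfolding trunc_log2_def using trunc_log_ge_1[of "x\<^sup>2"] tl by (intro trunc_log_mono) auto
  \<comment> \<open>Doubling the argument adds \<open>ln 2 < 1\<close> to the logarithm, and 1 is at
    most \<open>trunc_log2 x\<close>.\<close>
  also have "\<dots> \<le> 2 * trunc_log2 x"
    using trunc_log_ge_1[of x] ln_2_less_1 by (auto simp: trunc_log2_def trunc_log_def ln_mult)
  finally have "trunc_log2 (x\<^sup>2) powr (1 + \<epsilon>) \<le> (2 * trunc_log2 x) powr (1 + \<epsilon>)"
    using assms trunc_log2_ge_1[of "x\<^sup>2"] by (intro powr_mono2) auto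
  also have "\<dots> = 2 powr (1 + \<epsilon>) * trunc_log2 x powr (1 + \<epsilon>)"
    using trunc_log2_ge_1[of x] by (intro powr_mult)
  finally have "log_weight \<epsilon> (x\<^sup>2) \<le> (2 * trunc_log x) * (2 powr (1 + \<epsilon>) * trunc_log2 x powr (1 + \<epsilon>))"
    unfolding log_weight_def using tl trunc_log_ge_1[of x] by (intro mult_mono) auto
  also have "\<dots> = 2 powr (2 + \<epsilon>) * log_weight \<epsilon> x"
    by (simp add: log_weight_def powr_add)
  finally show ?thesis .
qed

text \<open>The threshold is 81 = 3^4: from e \<le> 3 follows \<open>ln 3 \<ge> 1\<close>, so ln 81
  \<ge> 4, which exceeds e. From here on both truncations are inactive.\<close>

lemma ln_ln_ge_1:
  assumes "(x::real) \<ge> 81"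
  shows "ln (ln x) \<ge> 1"
proof -
  have "(4::real) \<le> 4 * ln 3"
    using exp_le ln_ge_iff[of 3 1] by simp
  also have "\<dots> = ln (3 ^ 4)" by (subst ln_realpow) auto
  also have "\<dots> \<le> ln x" using assms by simp
  finally have "exp 1 \<le> ln x" using exp_le by linarith
  then show ?thesis using ln_ge_iff[of "ln x" 1] exp_gt_zero[of "1::real"] by linarith
qed

lemma ln_gt_1:
  assumes "(x::real) \<ge> 81"
  shows "ln x > 1"
proof -
  have "0 < ln (ln x)" using ln_ln_ge_1[OF assms] by linarith
  then show ?thesis using assms by (intro ln_gt_zero_imp_gt_one) auto
qed

lemma log_weight_eq:
  assumes "x \<ge> 81"
  shows "log_weight \<epsilon> x = ln x * ln (ln x) powr (1 + \<epsilon>)"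
  using ln_ln_ge_1[OF assms] ln_gt_1[OF assms]
  by (simp add: log_weight_def trunc_log2_def trunc_log_def)

text \<open>The function \<open>- (ln (ln x) powr (- \<epsilon>))\<close> has derivative
  \<open>\<epsilon> / (x * log_weight \<epsilon> x)\<close>. By the mean value theorem its increment
  is \<open>v - u\<close> times a value of this derivative, which decreases and so is at least its
  value at \<open>v\<close>.\<close>

lemma log_weight_le_primitive_diff:
  assumes "\<epsilon> > 0" "81 \<le> u" "u \<le> v"
  shows "\<epsilon> * (v - u) / (v * log_weight \<epsilon> v) \<le> ln (ln u) powr (- \<epsilon>) - ln (ln v) powr (- \<epsilon>)"
proof (cases "u = v")
  case False
  let ?F = "\<lambda>x. - (ln (ln x) powr (- \<epsilon>))"
  have "\<exists>z. u < z \<and> z < v \<and> ?F v - ?F u = (v - u) * (\<epsilon> / (z * log_weight \<epsilon> z))"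
  proof (rule MVT2)
    show "u < v" using False assms by simp
    fix x assume "u \<le> x" "x \<le> v"
    then have x: "x \<ge> 81" using assms by simp
    then have l: "ln (ln x) \<ge> 1" by (rule ln_ln_ge_1)
    moreover have "ln x > 1" using x by (rule ln_gt_1)
    ultimately show "(?F has_real_derivative \<epsilon> / (x * log_weight \<epsilon> x)) (at x)"
      using x unfolding log_weight_eq[OF x]
      by (auto intro!: derivative_eq_intros simp: powr_minus powr_add powr_diff field_simps)
  qed
  then obtain z where z: "u < z" "z < v"
    and eq: "?F v - ?F u = (v - u) * (\<epsilon> / (z * log_weight \<epsilon> z))" by blast
  have "z * log_weight \<epsilon> z \<le> v * log_weight \<epsilon> v"
    using z assms log_weight_ge_1[of \<epsilon> z] by (intro mult_mono log_weight_mono) auto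
  moreover have "z * log_weight \<epsilon> z > 0"
    using z assms log_weight_ge_1[of \<epsilon> z] by (intro mult_pos_pos) auto
  ultimately have "(v - u) * (\<epsilon> / (v * log_weight \<epsilon> v)) \<le> (v - u) * (\<epsilon> / (z * log_weight \<epsilon> z))"
    using assms by (intro mult_left_mono frac_le) auto
  then show ?thesis using eq by (simp add: mult.commute)
qed simp

section \<open>Convergence of the series of new differences\<close>

lemma summable_increments:
  fixes D :: "nat \<Rightarrow> nat"
  assumes "\<epsilon> > 0" "mono D" and D_le: "\<And>N. D N \<le> N * (N - 1)" and D_pos: "\<And>N. N \<ge> 2 \<Longrightarrow> D N \<ge> 1"
  shows "summable (\<lambda>N. (real (D (Suc N)) - real (D N)) /
    (real (D (Suc N)) * log_weight \<epsilon> (real (Suc N))))"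
proof -
  \<comment> \<open>The shift by 81 keeps the argument where \<open>ln (ln x) \<ge> 1\<close>; it costs a factor 82, as \<open>D N \<ge> 1\<close>.\<close>
  define G where "G = (\<lambda>N. ln (ln (real (D N) + 81)) powr (- \<epsilon>))"
  have D_mono: "real (D N) \<le> real (D (Suc N))" for N
    using \<open>mono D\<close> by (simp add: monoD)
  have G_diff: "\<epsilon> * (real (D (Suc N)) - real (D N)) / ((real (D (Suc N)) + 81) * log_weight \<epsilon> (real (D (Suc N)) + 81))
      \<le> G N - G (Suc N)" for N
    using log_weight_le_primitive_diff[of \<epsilon> "real (D N) + 81" "real (D (Suc N)) + 81"] D_mono[of N] assms
    by (simp add: G_def)
  have "decseq G"
  proof (rule decseq_SucI)
    fix N
    have "0 \<le> \<epsilon> * (real (D (Suc N)) - real (D N)) / ((real (D (Suc N)) + 81) * log_weight \<epsilon> (real (D (Suc N)) + 81))"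
      using \<open>\<epsilon> > 0\<close> D_mono[of N] log_weight_ge_1[of \<epsilon> "real (D (Suc N)) + 81"]
      by (intro divide_nonneg_nonneg mult_nonneg_nonneg) auto
    then show "G (Suc N) \<le> G N" using G_diff[of N] by linarith
  qed
  \<comment> \<open>\<open>G\<close> decreases and is bounded below by 0.\<close>
  then obtain L where "G \<longlonglongrightarrow> L"
    by (rule decseq_convergent[of G 0]) (auto simp: G_def)
  \<comment> \<open>The 82 comes from \<open>d + 81 \<le> 82 * d\<close>, the power of 2 from
    \<open>log_weight_square_le\<close>, and the division by \<epsilon> from the primitive.\<close>
  define C where "C = 82 * 2 powr (2 + \<epsilon>) / \<epsilon>"
  have "summable (\<lambda>N. C * (G N - G (Suc N)))"
    using \<open>G \<longlonglongrightarrow> L\<close> by (intro summable_mult telescope_summable')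
  then show ?thesis
  proof (rule summable_comparison_test_ev[rotated])
    show "\<forall>\<^sub>F N in sequentially. norm ((real (D (Suc N)) - real (D N)) /
        (real (D (Suc N)) * log_weight \<epsilon> (real (Suc N)))) \<le> C * (G N - G (Suc N))"
      using eventually_ge_at_top[of 81]
    proof eventually_elim
      case (elim N)
      define d where "d = real (D (Suc N))"
      define e where "e = d - real (D N)"
      let ?w = "log_weight \<epsilon> (real (Suc N))" and ?w' = "log_weight \<epsilon> (d + 81)"
      have "d \<ge> 1" using D_pos[of "Suc N"] elim by (simp add: d_def)
      have "e \<ge> 0" using D_mono by (simp add: d_def e_def)
      have w: "?w \<ge> 1" "?w' \<ge> 1" using \<open>\<epsilon> > 0\<close> log_weight_ge_1 by auto
      \<comment> \<open>The bound \<open>Suc N * N\<close> on \<open>D (Suc N)\<close> falls short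
        of the square by \<open>Suc N\<close>, which absorbs the shift by 81.\<close>
      have "D (Suc N) + 81 \<le> (Suc N)\<^sup>2"
        using D_le[of "Suc N"] elim by (simp add: power2_eq_square)
      then have "d + 81 \<le> (real (Suc N))\<^sup>2"
        unfolding d_def by (metis of_nat_add of_nat_le_iff of_nat_numeral of_nat_power)
      then have "?w' \<le> log_weight \<epsilon> ((real (Suc N))\<^sup>2)"
        using \<open>\<epsilon> > 0\<close> \<open>d \<ge> 1\<close> by (intro log_weight_mono) auto
      also have "\<dots> \<le> 2 powr (2 + \<epsilon>) * ?w"
        using \<open>\<epsilon> > 0\<close> by (intro log_weight_square_le) auto
      finally have "(d + 81) * ?w' \<le> (82 * d) * (2 powr (2 + \<epsilon>) * ?w)"
        using \<open>d \<ge> 1\<close> w by (intro mult_mono) auto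
      then have "(d + 81) * ?w' \<le> C * \<epsilon> * (d * ?w)"
        using \<open>\<epsilon> > 0\<close> by (simp add: C_def mult_ac)
      then have "e * ((d + 81) * ?w') \<le> e * (C * \<epsilon> * (d * ?w))"
        using \<open>e \<ge> 0\<close> by (rule mult_left_mono)
      moreover have "(d + 81) * ?w' > 0" "d * ?w > 0"
        using \<open>d \<ge> 1\<close> w by (auto intro!: mult_pos_pos)
      ultimately have "e / (d * ?w) \<le> C * (\<epsilon> * e / ((d + 81) * ?w'))"
        by (simp add: divide_simps mult_ac)
      also have "\<dots> \<le> C * (G N - G (Suc N))"
        using \<open>\<epsilon> > 0\<close> G_diff[of N] by (intro mult_left_mono) (auto simp: C_def d_def e_def)
      finally have "e / (d * ?w) \<le> C * (G N - G (Suc N))" .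
      moreover have "0 \<le> e / (d * ?w)"
        using \<open>e \<ge> 0\<close> \<open>d * ?w > 0\<close> by simp
      ultimately show ?case by (simp add: d_def e_def)
    qed
  qed
qed

section \<open>Borel-Cantelli and the two bounds\<close>

theorem mainTheorem2:
  fixes a c :: "nat \<Rightarrow> real" and \<epsilon> :: real
  assumes a_pos: "\<And>n. n \<ge> 1 \<Longrightarrow> a n > 0"
    and a_distinct: "inj_on a {1..}"
    and c_pos: "\<And>N. N \<ge> 1 \<Longrightarrow> c N > 0"
    and c_decreasing: "antimono_on {1..} c"
    and gap: "\<And>N. N \<ge> 1 \<Longrightarrow> (INF (m, n)\<in>index_pairs N. ereal \<bar>a m - a n\<bar>) \<ge> ereal (c N)"
    and eps_pos: "\<epsilon> > 0"
  shows "AE \<alpha> in lebesgue_on {0..1}. \<forall>\<^sub>F N in sequentially.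
    delta_min a \<alpha> N \<ge>
      c N / (real (num_differences a N) * trunc_log (real N) * trunc_log2 (real N) powr (1 + \<epsilon>)) \<and>
    delta_min a \<alpha> N \<le>
      1 - c N / (real (num_differences a N) * trunc_log (real N) * trunc_log2 (real N) powr (1 + \<epsilon>))"
proof -
  let ?D = "\<lambda>N. real (num_differences a N)"
  define \<eta> where "\<eta> = (\<lambda>N. c N / (?D N * log_weight \<epsilon> (real N)))"
  have \<eta>_nonneg: "\<eta> N \<ge> 0" if "N \<ge> 1" for N
    using c_pos[OF that] log_weight_ge_1[OF eps_pos, of "real N"] by (simp add: \<eta>_def)
  have c_mono: "c N \<le> c M" if "1 \<le> M" "M \<le> N" for M N
    using c_decreasing that by (auto simp: monotone_on_def)
  \<comment> \<open>The range starts at 2 because \<open>num_differences a 1\<close> is 0, so that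
    \<open>\<eta> 1\<close> is 0 by the convention for division by zero.\<close>
  have \<eta>_antimono: "\<eta> N \<le> \<eta> M" if "2 \<le> M" "M \<le> N" for M N
    unfolding \<eta>_def
  proof (rule frac_le)
    show "0 < ?D M * log_weight \<epsilon> (real M)"
      using num_differences_pos[of M a] log_weight_ge_1[OF eps_pos, of "real M"] that
      by (intro mult_pos_pos) auto
    show "?D M * log_weight \<epsilon> (real M) \<le> ?D N * log_weight \<epsilon> (real N)"
      using that eps_pos log_weight_ge_1[OF eps_pos, of "real M"] num_differences_mono[of M N a]
      by (intro mult_mono log_weight_mono) auto
  qed (use that c_mono[of M N] c_pos[of M] in auto)
  have \<eta>_tendsto_0: "\<eta> \<longlonglongrightarrow> 0"
  proof (rule tendsto_sandwich[of "\<lambda>_. 0" _ _ "\<lambda>N. c 1 / ln (real N)"])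
    show "(\<lambda>N. c 1 / ln (real N)) \<longlonglongrightarrow> 0" by real_asymp
    show "\<forall>\<^sub>F N in sequentially. 0 \<le> \<eta> N"
      using eventually_ge_at_top[of 1] by eventually_elim (rule \<eta>_nonneg)
    show "\<forall>\<^sub>F N in sequentially. \<eta> N \<le> c 1 / ln (real N)"
      using eventually_ge_at_top[of 2]
    proof eventually_elim
      case (elim N)
      have "ln (real N) \<le> log_weight \<epsilon> (real N)"
        using log_weight_ge_trunc_log[OF eps_pos, of "real N"] by (simp add: trunc_log_def)
      also have "\<dots> \<le> ?D N * log_weight \<epsilon> (real N)"
        using num_differences_pos[OF elim, of a] log_weight_ge_1[OF eps_pos, of "real N"]
        by (simp add: mult_le_cancel_right1)
      finally show ?case
        unfolding \<eta>_def using elim c_mono[of 1 N] c_pos[of 1] by (intro frac_le) auto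
    qed
  qed auto
  have differences_ge: "d \<ge> c N" if "d \<in> differences a N" "N \<ge> 1" for d N
  proof -
    obtain m n where mn: "(m, n) \<in> index_pairs N" "d = \<bar>a m - a n\<bar>"
      using \<open>d \<in> differences a N\<close> by (auto simp: differences_def)
    \<comment> \<open>In \<open>ereal\<close> the infimum over the empty set is infinite, so
      \<open>gap\<close> is vacuous at \<open>N = 1\<close>; here \<open>mn\<close> supplies a
      pair.\<close>
    have "ereal (c N) \<le> (INF (m, n)\<in>index_pairs N. ereal \<bar>a m - a n\<bar>)" using gap that by simp
    also have "\<dots> \<le> ereal d" using mn by (intro INF_lower2[of "(m, n)"]) auto
    finally show ?thesis by simp
  qed
  have differences_pos: "d > 0" if "d \<in> differences a N" for d N
    using differences_ge[OF that] c_pos[of N] that by (cases N) force+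

  \<comment> \<open>Only differences new at \<open>Suc N\<close> are tested, against the threshold
    of that index.\<close>
  define A where "A = (\<lambda>N. \<Union>d\<in>differences a (Suc N) - differences a N. close_multipliers d (\<eta> (Suc N)))"
  have A_lmeasurable: "A N \<in> lmeasurable" for N
    unfolding A_def by (intro fmeasurable.finite_UN close_multipliers_lmeasurable) auto
  have A_measure_le: "measure lebesgue (A N) \<le>
      (2 * c 1 + 4) * ((?D (Suc N) - ?D N) / (?D (Suc N) * log_weight \<epsilon> (real (Suc N))))" for N
  proof -
    let ?K = "(2 * c 1 + 4) / (?D (Suc N) * log_weight \<epsilon> (real (Suc N)))"
    have cN: "c (Suc N) > 0" "c (Suc N) \<le> c 1" using c_pos c_mono by auto
    have "measure lebesgue (A N) \<le> (\<Sum>d\<in>differences a (Suc N) - differences a N.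
        measure lebesgue (close_multipliers d (\<eta> (Suc N))))"
      unfolding A_def by (intro measure_UNION_le fmeasurableD close_multipliers_lmeasurable) auto
    also have "\<dots> \<le> (\<Sum>d\<in>differences a (Suc N) - differences a N. ?K)"
    proof (intro sum_mono)
      fix d assume "d \<in> differences a (Suc N) - differences a N"
      then have d: "d \<ge> c (Suc N)" "d > 0" using differences_ge differences_pos by auto
      have "measure lebesgue (close_multipliers d (\<eta> (Suc N))) \<le> 2 * \<eta> (Suc N) + 4 * \<eta> (Suc N) / d"
        using d \<eta>_nonneg by (intro measure_close_multipliers_le) auto
      \<comment> \<open>Here the gap hypothesis enters: replacing \<open>d\<close> by
        \<open>c (Suc N)\<close> cancels the numerator of \<eta> in the second term. In the first,
        \<open>c (Suc N)\<close> is later bounded by \<open>c 1\<close>.\<close>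
      also have "\<dots> \<le> 2 * \<eta> (Suc N) + 4 * \<eta> (Suc N) / c (Suc N)"
        using d cN \<eta>_nonneg[of "Suc N"] by (intro add_left_mono divide_left_mono) auto
      also have "\<dots> = (2 * c (Suc N) + 4) / (?D (Suc N) * log_weight \<epsilon> (real (Suc N)))"
        using cN by (simp add: \<eta>_def add_divide_distrib)
      also have "\<dots> \<le> ?K"
        using cN log_weight_ge_1[OF eps_pos, of "real (Suc N)"] by (intro divide_right_mono) auto
      finally show "measure lebesgue (close_multipliers d (\<eta> (Suc N))) \<le> ?K" .
    qed
    \<comment> \<open>The difference sets are nested, so the number of new differences is the
      increment of \<open>?D\<close>.\<close>
    also have "\<dots> = (?D (Suc N) - ?D N) * ?K"
      using differences_mono[of N "Suc N" a] num_differences_mono[of N "Suc N" a]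
      by (simp add: card_Diff_subset num_differences_eq_card of_nat_diff)
    finally show ?thesis by (simp add: mult_ac)
  qed
  have "summable (\<lambda>N. measure lebesgue (A N))"
  proof (rule summable_comparison_test')
    show "summable (\<lambda>N. (2 * c 1 + 4) *
        ((?D (Suc N) - ?D N) / (?D (Suc N) * log_weight \<epsilon> (real (Suc N)))))"
      by (intro summable_mult summable_increments eps_pos monoI num_differences_mono
          num_differences_le num_differences_pos)
    show "norm (measure lebesgue (A N)) \<le> (2 * c 1 + 4) *
        ((?D (Suc N) - ?D N) / (?D (Suc N) * log_weight \<epsilon> (real (Suc N))))" if "N \<ge> 0" for N
      using A_measure_le[of N] by simp
  qed
  then have "AE \<alpha> in lebesgue. \<forall>\<^sub>F N in sequentially. \<alpha> \<in> space lebesgue - A N"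
    using A_lmeasurable by (intro borel_cantelli_AE1) (auto simp del: emeasure_completion simp: fmeasurable_def)
  moreover have "AE \<alpha> in lebesgue. \<forall>d\<in>(\<Union>N. differences a N). \<alpha> * d \<notin> (\<int> :: real set)"
    using differences_pos by (intro AE_mult_notin_Ints countable_UN) (auto simp: countable_finite dest: differences_pos)
  ultimately have "AE \<alpha> in lebesgue. \<alpha> \<in> {0..1} \<longrightarrow> (\<forall>\<^sub>F N in sequentially.
      delta_min a \<alpha> N \<ge> \<eta> N \<and> delta_min a \<alpha> N \<le> 1 - \<eta> N)"
  proof eventually_elim
    case (elim \<alpha>)
    show ?case
    proof
      assume \<alpha>: "\<alpha> \<in> {0..1}"
      obtain N0 where N0: "\<And>N. N \<ge> N0 \<Longrightarrow> \<alpha> \<notin> A N"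
        using elim(1) by (auto simp: eventually_sequentially)
      \<comment> \<open>The maximum with 1 ensures \<open>Suc M \<ge> 2\<close> for
        \<open>M \<ge> N1\<close>, where \<open>\<eta>_antimono\<close> applies.\<close>
      define N1 where "N1 = max 1 N0"
      \<comment> \<open>Borel-Cantelli says nothing about these finitely many early differences.
        Each has a fixed positive distance, which \<eta> eventually undercuts.\<close>
      have "\<forall>\<^sub>F N in sequentially. \<forall>d\<in>differences a N1. \<eta> N < dist_nearest_int (\<alpha> * d)"
      proof (intro eventually_ball_finite ballI)
        fix d assume "d \<in> differences a N1"
        then have "dist_nearest_int (\<alpha> * d) > 0" using elim(2) by (intro dist_nearest_int_pos) auto
        then show "\<forall>\<^sub>F N in sequentially. \<eta> N < dist_nearest_int (\<alpha> * d)"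
          by (rule order_tendstoD(2)[OF \<eta>_tendsto_0])
      qed simp
      moreover have "\<forall>\<^sub>F N in sequentially. \<eta> N < 1/2"
        by (rule order_tendstoD(2)[OF \<eta>_tendsto_0]) simp
      ultimately show "\<forall>\<^sub>F N in sequentially. delta_min a \<alpha> N \<ge> \<eta> N \<and> delta_min a \<alpha> N \<le> 1 - \<eta> N"
        using eventually_ge_at_top[of 2]
      proof eventually_elim
        case (elim N)
        have *: "\<eta> N \<le> dist_nearest_int (\<alpha> * d)" if d: "d \<in> differences a N" for d
        proof -
          obtain M where M: "M < N" "d \<in> differences a (Suc M) - differences a M"
            using first_appearance_of_difference[OF d] .
          show ?thesis
          proof (cases "M < N1")
            case True
            then have "d \<in> differences a N1" using M differences_mono[of "Suc M" N1 a] by auto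
            then show ?thesis using elim(1) by force
          next
            case False
            then have "\<alpha> \<notin> close_multipliers d (\<eta> (Suc M))"
              using M N0[of M] by (auto simp: A_def N1_def)
            then have "\<eta> (Suc M) \<le> dist_nearest_int (\<alpha> * d)"
              using \<alpha> by (auto simp: close_multipliers_def)
            moreover have "\<eta> N \<le> \<eta> (Suc M)"
              using False M by (intro \<eta>_antimono) (auto simp: N1_def)
            ultimately show ?thesis by simp
          qed
        qed
        let ?S = "(\<lambda>(m, n). dist_nearest_int (\<alpha> * (a m - a n))) ` index_pairs N"
        have S_ge: "\<eta> N \<le> x" if "x \<in> ?S" for x
        proof -
          obtain m n where mn: "(m, n) \<in> index_pairs N" "x = dist_nearest_int (\<alpha> * (a m - a n))"
            using \<open>x \<in> ?S\<close> by auto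
          then have "\<bar>a m - a n\<bar> \<in> differences a N" by (force simp: differences_def)
          from *[OF this] show ?thesis using mn by (simp add: dist_nearest_int_mult_abs)
        qed
        have "finite ?S" by (simp add: finite_index_pairs)
        moreover have "?S \<noteq> {}" using elim(3) by (simp add: index_pairs_nonempty)
        ultimately have "delta_min a \<alpha> N \<in> ?S" unfolding delta_min_def by (rule Min_in)
        \<comment> \<open>Together with \<open>\<eta> N < 1/2\<close> this yields the upper bound
          (b).\<close>
        moreover from this have "delta_min a \<alpha> N \<le> 1/2"
          using dist_nearest_int_le_half by auto
        ultimately show ?case using S_ge elim(2) by auto
      qed
    qed
  qed
  then show ?thesis
    by (subst AE_restrict_space_iff) (simp_all add: \<eta>_def log_weight_def mult_ac)
qed

end
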